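(* Let $l_1,l_2,m\ge1$ be integers and $x,y,z\in[-1,1)$. Then \begin{align*} &\sum_{n=1}^\infty\frac{\zeta_n(l_1,x)\zeta_n(l_2,y)}{n^m}z^n+\sum_{n=1}^\infty\frac{\zeta_n(l_1,x)\zeta_n(m,z)}{n^{l_2}}y^n+\sum_{n=1}^\infty\frac{\zeta_n(l_2,y)\zeta_n(m,z)}{n^{l_1}}x^n\\ &=\sum_{n=1}^\infty\frac{\zeta_n(m,z)}{n^{l_1+l_2}}(xy)^n+\sum_{n=1}^\infty\frac{\zeta_n(l_1,x)}{n^{m+l_2}}(yz)^n+\sum_{n=1}^\infty\frac{\zeta_n(l_2,y)}{n^{l_1+m}}(xz)^n\\ &\quad+\mathrm{Li}_m(z)\mathrm{Li}_{l_1}(x)\mathrm{Li}_{l_2}(y)-\mathrm{Li}_{l_1+l_2+m}(xyz). \end{align*}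
   Context: For an integer $l\ge1$ and $x\in[-1,1]$, $\zeta_n(l,x)=\sum_{k=1}^n\frac{x^k}{k^l}$. $\mathrm{Li}_p(x)=\sum_{n\ge1}x^n/n^p$ (with $\mathrm{Li}_1(x)=-\ln(1-x)$). *)

theory Defs
  imports "HOL-Analysis.Analysis"
begin

definition zeta_fin :: "nat \<Rightarrow> nat \<Rightarrow> real \<Rightarrow> real" where
  "zeta_fin n l x = (\<Sum>k=1..n. x ^ k / real k ^ l)"

text \<open>
  Series over \<open>n \<ge> 1\<close> are written with \<open>Suc n\<close>, \<open>n \<ge> 0\<close>. They are sums of
  sequences (limits of partial sums), since convergence is in general only conditional at \<open>-1\<close>.
\<close>

definition Li :: "nat \<Rightarrow> real \<Rightarrow> real" where
  "Li p x = (\<Sum>n. x ^ Suc n / real (Suc n) ^ p)"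

lemma Li_1:
  assumes "x \<in> {-1..<1}"
  shows "Li 1 x = - ln (1 - x)"
proof (cases "x = -1")
  case True
  have "(\<lambda>k. - ((-1)^k / real_of_nat (Suc k))) sums (- ln 2)"
    using alternating_harmonic_series_sums sums_minus by blast
  then show ?thesis
    unfolding Li_def using True by (simp add: sums_iff)
next
  case False
  with assms have "\<bar>x\<bar> < 1" by auto
  then have "(\<lambda>n. - ((-(-x)) ^ n) / of_nat n) sums ln (1 + (-x))"
    by (intro ln_series') auto
  then have "(\<lambda>n. - (- (x ^ n) / real n)) sums (- ln (1 - x))"
    by (auto dest: sums_minus)
  then have "(\<lambda>n. x ^ Suc n / real (Suc n)) sums (- ln (1 - x))"
    by (subst sums_Suc_iff) simp
  then show ?thesis
    unfolding Li_def by (simp add: sums_iff)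
qed

end

theory Submission
  imports Defs
begin

text \<open>
  With \<open>A\<^sub>n, B\<^sub>n, C\<^sub>n\<close> the three finite sums and \<open>a\<^sub>n, b\<^sub>n, c\<^sub>n\<close> their increments, expanding
  \<open>A\<^sub>n B\<^sub>n C\<^sub>n - (A\<^sub>n - a\<^sub>n) (B\<^sub>n - b\<^sub>n) (C\<^sub>n - c\<^sub>n)\<close> gives the summands of the identity, so its partial
  sums telescope to \<open>A\<^sub>n B\<^sub>n C\<^sub>n\<close>. Convergence of the individual series rests on
  \<open>A\<^sub>n = A + O(1/n)\<close>, valid on all of \<open>[-1, 1)\<close> by summation by parts: then
  \<open>a\<^sub>n B\<^sub>n C\<^sub>n = B C a\<^sub>n + O(1/n\<^sup>2)\<close>, even where \<open>\<Sum>a\<^sub>n\<close> converges only conditionally.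
\<close>

text \<open>Summation by parts: multiplying by \<open>1 - x\<close> leaves one boundary term at each
  end and the decrements of \<open>w\<close> weighted by powers of \<open>x\<close>. As
  \<open>\<bar>x\<bar> \<le> 1\<close>, the total is at most \<open>w N + (w N - w j) + w j\<close>,
  where \<open>j\<close> is the last index. The bound does not involve \<open>M\<close>, so it also
  controls infinite tails.\<close>

lemma abs_sum_power_decseq_le:
  fixes w :: "nat \<Rightarrow> real" and x :: real
  assumes x: "x \<in> {-1..<1}" and w: "decseq w" "\<And>k. w k \<ge> 0"
  shows "\<bar>\<Sum>k=N..<M. x ^ Suc k * w k\<bar> \<le> 2 * w N / (1 - x)"
proof (cases "N < M")
  case False
  then show ?thesis using x w(2)[of N] by simp
next
  case True
  have pow: "\<bar>x ^ k * v\<bar> \<le> v" if "v \<ge> 0" for k and v :: real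
  proof -
    have "\<bar>x\<bar> ^ k \<le> 1" using x by (intro power_le_one) auto
    then show ?thesis using that by (simp add: abs_mult power_abs mult_left_le_one_le)
  qed
  \<comment> \<open>With the upper boundary term moved to the left, each induction step changes the
    expression by a single decrement term. The right side is \<open>w N\<close> for the lower
    boundary plus the telescoped decrements \<open>w N - w j\<close>; the missing \<open>w j\<close>
    later pays for removing the upper boundary term.\<close>
  have part: "\<bar>(1 - x) * (\<Sum>k=N..<Suc j. x ^ Suc k * w k) + x ^ Suc (Suc j) * w j\<bar> \<le> 2 * w N - w j"
    if "N \<le> j" for j
    using that
  proof (induction j rule: dec_induct)
    case base
    have "(1 - x) * (\<Sum>k=N..<Suc N. x ^ Suc k * w k) + x ^ Suc (Suc N) * w N = x ^ Suc N * w N"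
      by (simp add: algebra_simps)
    then show ?case using pow[OF w(2)[of N], of "Suc N"] by simp
  next
    case (step j)
    have "(1 - x) * (\<Sum>k=N..<Suc (Suc j). x ^ Suc k * w k) + x ^ Suc (Suc (Suc j)) * w (Suc j)
        = ((1 - x) * (\<Sum>k=N..<Suc j. x ^ Suc k * w k) + x ^ Suc (Suc j) * w j)
          - x ^ Suc (Suc j) * (w j - w (Suc j))"
      using step.hyps by (simp add: algebra_simps)
    moreover have "\<bar>x ^ Suc (Suc j) * (w j - w (Suc j))\<bar> \<le> w j - w (Suc j)"
      by (rule pow) (use decseq_SucD[OF w(1), of j] in simp)
    ultimately show ?case using step.IH by linarith
  qed
  obtain j where j: "M = Suc j" "N \<le> j" using True by (cases M) auto
  have "\<bar>(1 - x) * (\<Sum>k=N..<M. x ^ Suc k * w k)\<bar> \<le> 2 * w N"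
    using part[OF j(2)] pow[OF w(2)[of j], of "Suc (Suc j)"] unfolding j(1) by linarith
  then show ?thesis using x by (simp add: abs_mult field_simps)
qed

text \<open>Summation by parts with weights \<open>1 / real (Suc k) ^ l\<close>. The exponent is
  weakened to 1, the worst case, which gives one rate for all \<open>l\<close>.\<close>

lemma abs_sum_Li_terms_le:
  fixes x :: real
  assumes "x \<in> {-1..<1}" and "l \<ge> 1"
  shows "\<bar>\<Sum>k=N..<M. x ^ Suc k / real (Suc k) ^ l\<bar> \<le> 2 / (1 - x) / real (Suc N)"
proof -
  have "\<bar>\<Sum>k=N..<M. x ^ Suc k * (1 / real (Suc k) ^ l)\<bar> \<le> 2 * (1 / real (Suc N) ^ l) / (1 - x)"
    by (rule abs_sum_power_decseq_le)
       (use assms in \<open>auto simp: decseq_def intro!: divide_left_mono power_mono\<close>)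
  also have "\<dots> \<le> 2 * (1 / real (Suc N)) / (1 - x)"
    using assms self_le_power[of "real (Suc N)" l]
    by (intro divide_right_mono mult_left_mono divide_left_mono) auto
  finally show ?thesis by (simp add: mult.commute)
qed

text \<open>The Cauchy criterion is used because absolute convergence fails at
  \<open>x = -1\<close>, \<open>l = 1\<close>.\<close>

lemma summable_Li_terms:
  fixes x :: real
  assumes "x \<in> {-1..<1}" and "l \<ge> 1"
  shows "summable (\<lambda>n. x ^ Suc n / real (Suc n) ^ l)"
  unfolding summable_Cauchy
proof (intro allI impI)
  fix e :: real
  assume e: "e > 0"
  have "(\<lambda>N. 2 / (1 - x) / real (Suc N)) \<longlonglongrightarrow> 0"
    by (rule LIMSEQ_Suc) (rule lim_const_over_n)
  then have "eventually (\<lambda>N. 2 / (1 - x) / real (Suc N) < e) sequentially"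
    using e by (rule order_tendstoD(2))
  then obtain N0 where "\<And>N. N \<ge> N0 \<Longrightarrow> 2 / (1 - x) / real (Suc N) < e"
    unfolding eventually_sequentially by blast
  then show "\<exists>N0. \<forall>N\<ge>N0. \<forall>M. norm (\<Sum>k=N..<M. x ^ Suc k / real (Suc k) ^ l) < e"
    using abs_sum_Li_terms_le[OF assms] unfolding real_norm_def by (meson le_less_trans)
qed

lemma zeta_fin_conv_sum: "zeta_fin n l x = (\<Sum>k<n. x ^ Suc k / real (Suc k) ^ l)"
  by (induction n) (simp_all add: zeta_fin_def)

lemma zeta_fin_Suc: "zeta_fin (Suc n) l x = zeta_fin n l x + x ^ Suc n / real (Suc n) ^ l"
  by (simp add: zeta_fin_def)

lemma zeta_fin_tendsto_Li:
  assumes "x \<in> {-1..<1}" and "l \<ge> 1"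
  shows "(\<lambda>n. zeta_fin n l x) \<longlonglongrightarrow> Li l x"
  using summable_LIMSEQ[OF summable_Li_terms[OF assms]]
  by (simp add: zeta_fin_conv_sum Li_def)

text \<open>The bound on blocks is uniform in the upper end \<open>M\<close>, so it survives
  \<open>M\<close> tending to infinity.\<close>

lemma abs_Li_minus_zeta_fin_le:
  assumes "x \<in> {-1..<1}" and "l \<ge> 1"
  shows "\<bar>Li l x - zeta_fin n l x\<bar> \<le> 2 / (1 - x) / real (Suc n)"
proof (rule LIMSEQ_le_const2)
  show "(\<lambda>M. \<bar>zeta_fin M l x - zeta_fin n l x\<bar>) \<longlonglongrightarrow> \<bar>Li l x - zeta_fin n l x\<bar>"
    by (intro tendsto_intros zeta_fin_tendsto_Li assms)
  have "\<bar>zeta_fin M l x - zeta_fin n l x\<bar> \<le> 2 / (1 - x) / real (Suc n)" if "n \<le> M" for M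
  proof -
    have "zeta_fin M l x - zeta_fin n l x = (\<Sum>k=n..<M. x ^ Suc k / real (Suc k) ^ l)"
      using sum_diff_nat_ivl[of 0 n M "\<lambda>k. x ^ Suc k / real (Suc k) ^ l"] that
      by (simp add: zeta_fin_conv_sum atLeast0LessThan)
    then show ?thesis using abs_sum_Li_terms_le[OF assms] by simp
  qed
  then show "\<exists>N. \<forall>M\<ge>N. \<bar>zeta_fin M l x - zeta_fin n l x\<bar> \<le> 2 / (1 - x) / real (Suc n)"
    by blast
qed

lemma zeta_fin_minus_Li_bigo:
  assumes "x \<in> {-1..<1}" and "l \<ge> 1"
  shows "(\<lambda>n. zeta_fin (Suc n) l x - Li l x) \<in> O(\<lambda>n. 1 / real (Suc n))"
proof (rule bigoI[where c = "2 / (1 - x)"], intro always_eventually allI)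
  fix n
  have "\<bar>zeta_fin (Suc n) l x - Li l x\<bar> \<le> 2 / (1 - x) / real (Suc (Suc n))"
    using abs_Li_minus_zeta_fin_le[OF assms, of "Suc n"] by linarith
  also have "\<dots> \<le> 2 / (1 - x) / real (Suc n)"
    using assms by (intro divide_left_mono) auto
  finally show "norm (zeta_fin (Suc n) l x - Li l x) \<le> 2 / (1 - x) * norm (1 / real (Suc n))"
    by simp
qed

lemma zeta_fin_bigo_1:
  assumes "x \<in> {-1..<1}" and "l \<ge> 1"
  shows "(\<lambda>n. zeta_fin (Suc n) l x) \<in> O(\<lambda>_. 1)"
  using LIMSEQ_Suc[OF zeta_fin_tendsto_Li[OF assms]]
  by (intro bigoI_tendsto[where c = "Li l x"]) auto

text \<open>Applied with \<open>d = 1\<close> to a single increment and with \<open>d = 2\<close> to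
  products of two or three increments.\<close>

lemma Li_terms_bigo:
  fixes x :: real
  assumes "\<bar>x\<bar> \<le> 1" and "d \<le> l"
  shows "(\<lambda>n. x ^ Suc n / real (Suc n) ^ l) \<in> O(\<lambda>n. 1 / real (Suc n) ^ d)"
proof (rule bigoI[where c = 1], intro always_eventually allI)
  fix n
  have "\<bar>x ^ Suc n\<bar> / real (Suc n) ^ l \<le> 1 / real (Suc n) ^ d"
    using assms unfolding power_abs
    by (intro frac_le power_le_one power_increasing) auto
  then show "norm (x ^ Suc n / real (Suc n) ^ l) \<le> 1 * norm (1 / real (Suc n) ^ d)"
    by simp
qed

lemma summable_bigo_inverse_square:
  fixes f :: "nat \<Rightarrow> real"
  assumes "f \<in> O(\<lambda>n. 1 / real (Suc n) ^ 2)"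
  shows "summable f"
proof (rule summable_comparison_test_bigo[OF _ assms])
  have "summable (\<lambda>n. inverse (real (Suc n) ^ 2))"
    using inverse_power_summable[of 2, where 'a = real] by (subst summable_Suc_iff) simp
  then show "summable (\<lambda>n. norm (1 / real (Suc n) ^ 2))"
    by (simp add: inverse_eq_divide)
qed

lemma summable_zeta_fin_times_zeta_fin:
  assumes "x \<in> {-1..<1}" "k \<ge> 1" and "y \<in> {-1..<1}" "l \<ge> 1" and "z \<in> {-1..<1}" "m \<ge> 1"
  shows "summable (\<lambda>n. zeta_fin (Suc n) k x * zeta_fin (Suc n) l y / real (Suc n) ^ m * z ^ Suc n)"
proof -
  define c where "c n = z ^ Suc n / real (Suc n) ^ m" for n
  define A where "A n = zeta_fin (Suc n) k x" for n
  define B where "B n = zeta_fin (Suc n) l y" for n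
  have A: "(\<lambda>n. A n - Li k x) \<in> O(\<lambda>n. 1 / real (Suc n))"
    unfolding A_def by (rule zeta_fin_minus_Li_bigo) fact+
  have B: "(\<lambda>n. B n - Li l y) \<in> O(\<lambda>n. 1 / real (Suc n))"
    unfolding B_def by (rule zeta_fin_minus_Li_bigo) fact+
  have A1: "A \<in> O(\<lambda>_. 1)"
    unfolding A_def by (rule zeta_fin_bigo_1) fact+
  have c: "c \<in> O(\<lambda>n. 1 / real (Suc n))"
    unfolding c_def using Li_terms_bigo[of z 1 m] assms by (simp add: abs_le_iff)
  \<comment> \<open>This function is \<open>A n * B n - Li k x * Li l y\<close>, split so that each
    error meets a bounded factor. Multiplication by \<open>c n\<close> then gains the second factor
    \<open>1/n\<close>.\<close>
  have "(\<lambda>n. A n * (B n - Li l y) + Li l y * (A n - Li k x)) \<in> O(\<lambda>n. 1 / real (Suc n))"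
    using landau_o.big.mult[OF A1 B] A by (intro sum_in_bigo) simp_all
  from landau_o.big.mult[OF this c]
  have "summable (\<lambda>n. (A n * (B n - Li l y) + Li l y * (A n - Li k x)) * c n)"
    by (intro summable_bigo_inverse_square) (simp add: power2_eq_square)
  moreover have "summable (\<lambda>n. Li k x * Li l y * c n)"
    unfolding c_def by (intro summable_mult summable_Li_terms assms)
  ultimately have "summable (\<lambda>n. (A n * (B n - Li l y) + Li l y * (A n - Li k x)) * c n
      + Li k x * Li l y * c n)"
    by (rule summable_add)
  then show ?thesis
    by (simp add: A_def B_def c_def algebra_simps)
qed

text \<open>Exponent at least 2 gives absolute convergence, so \<open>u = 1\<close> is allowed; this
  value does occur, as \<open>x * y\<close> with \<open>x = y = -1\<close>.\<close>

lemma summable_zeta_fin_times_power: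
  assumes "x \<in> {-1..<1}" "k \<ge> 1" and "\<bar>u\<bar> \<le> 1" "p \<ge> 2"
  shows "summable (\<lambda>n. zeta_fin (Suc n) k x / real (Suc n) ^ p * u ^ Suc n)"
  using landau_o.big.mult[OF zeta_fin_bigo_1[OF assms(1,2)] Li_terms_bigo[OF assms(3,4)]]
  by (intro summable_bigo_inverse_square) simp

theorem theorem3p1:
  fixes l1 l2 m :: nat and x y z :: real
  assumes "l1 \<ge> 1" and "l2 \<ge> 1" and "m \<ge> 1"
    and "x \<in> {-1..<1}" and "y \<in> {-1..<1}" and "z \<in> {-1..<1}"
  shows
    "summable (\<lambda>n. zeta_fin (Suc n) l1 x * zeta_fin (Suc n) l2 y / real (Suc n) ^ m * z ^ Suc n) \<and>
     summable (\<lambda>n. zeta_fin (Suc n) l1 x * zeta_fin (Suc n) m z / real (Suc n) ^ l2 * y ^ Suc n) \<and>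
     summable (\<lambda>n. zeta_fin (Suc n) l2 y * zeta_fin (Suc n) m z / real (Suc n) ^ l1 * x ^ Suc n) \<and>
     summable (\<lambda>n. zeta_fin (Suc n) m z / real (Suc n) ^ (l1 + l2) * (x * y) ^ Suc n) \<and>
     summable (\<lambda>n. zeta_fin (Suc n) l1 x / real (Suc n) ^ (m + l2) * (y * z) ^ Suc n) \<and>
     summable (\<lambda>n. zeta_fin (Suc n) l2 y / real (Suc n) ^ (l1 + m) * (x * z) ^ Suc n) \<and>
     summable (\<lambda>n. z ^ Suc n / real (Suc n) ^ m) \<and>
     summable (\<lambda>n. x ^ Suc n / real (Suc n) ^ l1) \<and>
     summable (\<lambda>n. y ^ Suc n / real (Suc n) ^ l2) \<and>
     summable (\<lambda>n. (x * y * z) ^ Suc n / real (Suc n) ^ (l1 + l2 + m)) \<and>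
     (\<Sum>n. zeta_fin (Suc n) l1 x * zeta_fin (Suc n) l2 y / real (Suc n) ^ m * z ^ Suc n)
      + (\<Sum>n. zeta_fin (Suc n) l1 x * zeta_fin (Suc n) m z / real (Suc n) ^ l2 * y ^ Suc n)
      + (\<Sum>n. zeta_fin (Suc n) l2 y * zeta_fin (Suc n) m z / real (Suc n) ^ l1 * x ^ Suc n)
     = (\<Sum>n. zeta_fin (Suc n) m z / real (Suc n) ^ (l1 + l2) * (x * y) ^ Suc n)
      + (\<Sum>n. zeta_fin (Suc n) l1 x / real (Suc n) ^ (m + l2) * (y * z) ^ Suc n)
      + (\<Sum>n. zeta_fin (Suc n) l2 y / real (Suc n) ^ (l1 + m) * (x * z) ^ Suc n)
      + Li m z * Li l1 x * Li l2 y - Li (l1 + l2 + m) (x * y * z)"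
proof -
  have xyz: "\<bar>x\<bar> \<le> 1" "\<bar>y\<bar> \<le> 1" "\<bar>z\<bar> \<le> 1"
    using assms by auto
  then have prods: "\<bar>x * y\<bar> \<le> 1" "\<bar>y * z\<bar> \<le> 1" "\<bar>x * z\<bar> \<le> 1" "\<bar>x * y * z\<bar> \<le> 1"
    by (simp_all add: abs_mult mult_le_one)
  have exps: "l1 + l2 \<ge> 2" "m + l2 \<ge> 2" "l1 + m \<ge> 2" "l1 + l2 + m \<ge> 2"
    using assms by auto
  note S = summable_zeta_fin_times_zeta_fin
  note s1 = S[OF assms(4,1) assms(5,2) assms(6,3)]
  note s2 = S[OF assms(4,1) assms(6,3) assms(5,2)]
  note s3 = S[OF assms(5,2) assms(6,3) assms(4,1)]
  note t1 = summable_zeta_fin_times_power[OF assms(6,3) prods(1) exps(1)]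
  note t2 = summable_zeta_fin_times_power[OF assms(4,1) prods(2) exps(2)]
  note t3 = summable_zeta_fin_times_power[OF assms(5,2) prods(3) exps(3)]
  have u: "summable (\<lambda>n. (x * y * z) ^ Suc n / real (Suc n) ^ (l1 + l2 + m))"
    by (rule summable_bigo_inverse_square[OF Li_terms_bigo[OF prods(4) exps(4)]])
  define P where "P n = zeta_fin n l1 x * zeta_fin n l2 y * zeta_fin n m z" for n
  have "P \<longlonglongrightarrow> Li l1 x * Li l2 y * Li m z"
    unfolding P_def by (intro tendsto_mult zeta_fin_tendsto_Li assms)
  \<comment> \<open>Telescoping gives the limit minus \<open>P 0\<close>, and \<open>P 0 = 0\<close>
    because its factors are empty sums.\<close>
  from telescope_sums[OF this]
  have lim: "(\<lambda>n. P (Suc n) - P n) sums (Li m z * Li l1 x * Li l2 y)"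
    by (simp add: P_def zeta_fin_def mult_ac)
  \<comment> \<open>Inclusion-exclusion for one summand: \<open>A\<close>, \<open>B\<close>,
    \<open>C\<close> are the sums up to \<open>Suc n\<close>, so \<open>A - a / w1\<close> and its
    analogues are the sums up to \<open>n\<close>. Powers are abstracted to variables so that only a
    rational identity remains.\<close>
  have expand: "A * B / w3 * c + A * C / w2 * b + B * C / w1 * a
      - C / (w1 * w2) * (a * b) - A / (w3 * w2) * (b * c) - B / (w1 * w3) * (a * c)
      + a * b * c / (w1 * w2 * w3)
    = A * B * C - (A - a / w1) * (B - b / w2) * (C - c / w3)"
    if "w1 \<noteq> 0" "w2 \<noteq> 0" "w3 \<noteq> 0" for A B C a b c w1 w2 w3 :: real
    using that by (simp add: field_simps)
  have "(\<lambda>n.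
      zeta_fin (Suc n) l1 x * zeta_fin (Suc n) l2 y / real (Suc n) ^ m * z ^ Suc n
      + zeta_fin (Suc n) l1 x * zeta_fin (Suc n) m z / real (Suc n) ^ l2 * y ^ Suc n
      + zeta_fin (Suc n) l2 y * zeta_fin (Suc n) m z / real (Suc n) ^ l1 * x ^ Suc n
      - zeta_fin (Suc n) m z / real (Suc n) ^ (l1 + l2) * (x * y) ^ Suc n
      - zeta_fin (Suc n) l1 x / real (Suc n) ^ (m + l2) * (y * z) ^ Suc n
      - zeta_fin (Suc n) l2 y / real (Suc n) ^ (l1 + m) * (x * z) ^ Suc n
      + (x * y * z) ^ Suc n / real (Suc n) ^ (l1 + l2 + m)) = (\<lambda>n. P (Suc n) - P n)"
    unfolding power_add power_mult_distrib
    \<comment> \<open>Keeping \<open>x ^ Suc n\<close> and \<open>real (Suc n)\<close> folded lets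
      the last increment cancel literally against \<open>zeta_fin_Suc\<close>.\<close>
    by (subst expand) (simp_all add: P_def zeta_fin_Suc del: power_Suc of_nat_Suc)
  note eq = this
  have "(\<lambda>n. P (Suc n) - P n) sums (
      (\<Sum>n. zeta_fin (Suc n) l1 x * zeta_fin (Suc n) l2 y / real (Suc n) ^ m * z ^ Suc n)
      + (\<Sum>n. zeta_fin (Suc n) l1 x * zeta_fin (Suc n) m z / real (Suc n) ^ l2 * y ^ Suc n)
      + (\<Sum>n. zeta_fin (Suc n) l2 y * zeta_fin (Suc n) m z / real (Suc n) ^ l1 * x ^ Suc n)
      - (\<Sum>n. zeta_fin (Suc n) m z / real (Suc n) ^ (l1 + l2) * (x * y) ^ Suc n)
      - (\<Sum>n. zeta_fin (Suc n) l1 x / real (Suc n) ^ (m + l2) * (y * z) ^ Suc n)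
      - (\<Sum>n. zeta_fin (Suc n) l2 y / real (Suc n) ^ (l1 + m) * (x * z) ^ Suc n)
      + Li (l1 + l2 + m) (x * y * z))"
    unfolding eq[symmetric] Li_def
    by (intro sums_add sums_diff summable_sums s1 s2 s3 t1 t2 t3 u)
  \<comment> \<open>The same series has been summed termwise and by telescoping; equating the two
    values gives the identity up to rearrangement.\<close>
  from sums_unique2[OF this lim] show ?thesis
    by (intro conjI s1 s2 s3 t1 t2 t3 u summable_Li_terms assms) linarith
qed

end
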